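(* Let $t>1$, $0<\epsilon\le1$, $\mu\ge1$ and $\alpha,\beta\ge0$ integers. Let $f^1,f^2$ be tropically equivalent relatively elementary functions of $\alpha+2$ variables and $g^1,g^2$ tropically equivalent relatively elementary functions of $\beta+2$ variables. For $l=1,2$ let $$P_1^l(\epsilon,t,u,v,u_s,\dots,u_{\mu s},u_{\mu x})=0,\qquad P_2^l(\epsilon,t,u,v,v_x,\dots,u_{\mu x},v_{\mu x})=0$$ be the induced system of partial differential equations of order $\mu$ of $(f^l,g^l)$. Let $C$ be the bigger of the error constants of the two systems. Let $(u^l,v^l):[0,\infty)\times[0,\infty)\to(0,\infty)^2$ ($l=1,2$) be positive solutions, of class $C^{\mu+1}$, of the respective systems, such that $$0\le C\,K(u^l,v^l)\le(1-\delta)\epsilon^{-1}$$ for some $\delta>0$. Let $c$ and $M$ be the largest of the Lipschitz constants, respectively of the numbers of components, of the $(\max,+)$-functions corresponding to $f^1,f^2,g^1,g^2$; let $\gamma=\max(\alpha,\beta)$, $\tilde c=\max(c,1)$. Then for all $(x,s)\in[0,\infty)\times[0,\infty)$ $$\Big(\frac{u^1}{u^2}\Big)^{\pm1}(x,s),\ \Big(\frac{v^1}{v^2}\Big)^{\pm1}(x,s)\ \le\ (N_0M)^{6P_{\epsilon^{-1}(x+s(\gamma+1))}(c)}\ \big([(u^1,v^1):(u^2,v^2)]_\epsilon\big)^{\tilde c^{\,\epsilon^{-1}(x+s(\gamma+1))+1}},$$ where $N_0$ is any integer with $N_0\ge\max(\delta^{-1},2-\delta)$.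
   Context: $(a)^{\pm1}=\max(a,1/a)$; $P_r(c)=\frac{c^{r+1}-1}{c-1}$ for real $r\ge0$ ($P_r(1)=r+1$). A relative $(\max,+)$-function of $n$ variables is a function $\varphi:\mathbb R^n\to\mathbb R$ with a presentation $\varphi(\bar x)=\max_{1\le k\le m}(\alpha_k+\bar a_k\cdot\bar x)-\max_{1\le k\le l}(\beta_k+\bar b_k\cdot\bar x)$, $\alpha_k,\beta_k\in\mathbb R$, $\bar a_k,\bar b_k\in\mathbb Q^n$; its number of components is $ml$; Lipschitz constants are for the sup-norm. For $t>1$ the corresponding relatively elementary function is the quotient $\big(\sum_k t^{\alpha_k}\bar z^{\bar a_k}\big)/\big(\sum_k t^{\beta_k}\bar z^{\bar b_k}\big)$ on $(0,\infty)^n$. Two relatively elementary functions are tropically equivalent if their $(\max,+)$-functions coincide as functions. Induced system. Write $f=a_t/b_t$, $g=h_t/d_t$ as such quotients, where $a_t,b_t,h_t,d_t$ are polynomials with positive coefficients (exponents nonnegative integers). For functions $u,v$ on $[0,\infty)^2$ and $i\ge0$ put $T_iu=\sum_{k=0}^{\mu}\frac{(i\epsilon)^k}{k!}\partial_x^ku$ (similarly $T_iv$) and $T^su=\sum_{k=0}^\mu\frac{\epsilon^k}{k!}\partial_s^ku$. Then $P_1=b_t(v,T_0u,\dots,T_\alpha u)\,T^su-a_t(v,T_0u,\dots,T_\alpha u)$ and $P_2=d_t(v,T_0u,\dots,T_\beta u)\,T_1v-h_t(v,T_0u,\dots,T_\beta u)$, i.e. the polynomials obtained from $b_t\,u(x,s+\epsilon)-a_t$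 and $d_t\,v(x+\epsilon,s)-h_t$ by inserting Taylor expansions up to order $\mu$ of $u(x+i\epsilon,s)$, $u(x,s+\epsilon)$, $v(x+\epsilon,s)$ and dropping all monomials containing remainder terms (derivatives of order $\mu+1$). The system is $P_1=P_2=0$. The error terms ${\bf E}_1,{\bf E}_2$ are defined by $u(x,s+\epsilon)-f(v(x,s),u(x,s),\dots,u(x+\alpha\epsilon,s))=\dfrac{P_1}{b_t(v(x,s),u(x,s),\dots,u(x+\alpha\epsilon,s))}+\epsilon^{\mu+1}{\bf E}_1(x,s)$, $v(x+\epsilon,s)-g(v(x,s),u(x,s),\dots,u(x+\beta\epsilon,s))=\dfrac{P_2}{d_t(v(x,s),u(x,s),\dots,u(x+\beta\epsilon,s))}+\epsilon^{\mu+1}{\bf E}_2(x,s)$. Norms. For positive $u,v$ of class $C^{\mu+1}$: $\|(u,v)\|^1_{\mu,\alpha}(x,s)$ is the maximum of $\sup_{[x,x+\alpha\epsilon]\times\{s\}}|\partial_x^{\mu+1}u|$ and $\sup_{\{x\}\times[s,s+\epsilon]}|\partial_s^{\mu+1}u|$ if $\alpha\ge1$, and only the latter if $\alpha=0$; $\|(u,v)\|^2_{\mu,\beta}(x,s)$ is the maximum of $\sup_{[x,x+\beta\epsilon]\times\{s\}}|\partial_x^{\mu+1}u|$ and $\sup_{[x,x+\epsilon]\times\{s\}}|\partial_x^{\mu+1}v|$ if $\beta\ge1$, and only the latter if $\beta=0$. The error constant is the minimum number $C$ such that $|{\bf E}_1|(x,s)\le C\|(u,v)\|^1_{\mu,\alpha}(x,s)$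 and $|{\bf E}_2|(x,s)\le C\|(u,v)\|^2_{\mu,\beta}(x,s)$ pointwise for all such $u,v$, independently of $\epsilon$ and $t$ (it is assumed to exist). The higher distorsion is $$K(u,v)=\sup_{(x,s)\in[0,\infty)^2}\max\Big[\frac{\|(u,v)\|^1_{\mu,\alpha}(x,s)}{u(x,s+\epsilon)},\frac{\|(u,v)\|^2_{\mu,\beta}(x,s)}{v(x+\epsilon,s)}\Big].$$ Initial rate: $[(u,v):(u',v')]_\epsilon=\max\big[\sup_{[0,\infty)\times[0,\epsilon]}(u/u')^{\pm1},\ \sup_{[0,\epsilon]\times[0,\infty)}(v/v')^{\pm1}\big]$. *)

theory Defs
  imports "HOL-Analysis.Analysis"
begin

(* A point of R^n is a function nat => real of which only the values at indices < n are ever used.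
   A pair (a, e) stands for the affine form a + e . x, and also for the monomial t^a z^e. *)

type_synonym monomial = "real \<times> (nat \<Rightarrow> rat)"

record presentation =
  numer :: "monomial list"
  denom :: "monomial list"

definition wf_presentation :: "presentation \<Rightarrow> bool" where
  "wf_presentation p \<longleftrightarrow> numer p \<noteq> [] \<and> denom p \<noteq> []"

definition max_affine :: "nat \<Rightarrow> monomial list \<Rightarrow> (nat \<Rightarrow> real) \<Rightarrow> real" where
  "max_affine n L x = Max ((\<lambda>(a, e). a + (\<Sum>i<n. of_rat (e i) * x i)) ` set L)"

definition maxplus :: "nat \<Rightarrow> presentation \<Rightarrow> (nat \<Rightarrow> real) \<Rightarrow> real" where
  "maxplus n p x = max_affine n (numer p) x - max_affine n (denom p) x"

definition num_components :: "presentation \<Rightarrow> nat" where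
  "num_components p = length (numer p) * length (denom p)"

definition sup_dist :: "nat \<Rightarrow> (nat \<Rightarrow> real) \<Rightarrow> (nat \<Rightarrow> real) \<Rightarrow> real" where
  "sup_dist n x y = Max ((\<lambda>i. \<bar>x i - y i\<bar>) ` {..<n})"

definition lipschitz_const :: "nat \<Rightarrow> ((nat \<Rightarrow> real) \<Rightarrow> real) \<Rightarrow> real" where
  "lipschitz_const n \<phi> = Inf {L. 0 \<le> L \<and> (\<forall>x y. \<bar>\<phi> x - \<phi> y\<bar> \<le> L * sup_dist n x y)}"

definition elementary_sum :: "nat \<Rightarrow> real \<Rightarrow> monomial list \<Rightarrow> (nat \<Rightarrow> real) \<Rightarrow> real" where
  "elementary_sum n t L z = (\<Sum>(a, e)\<leftarrow>L. t powr a * (\<Prod>i<n. z i powr of_rat (e i)))"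

definition rel_elementary :: "nat \<Rightarrow> real \<Rightarrow> presentation \<Rightarrow> (nat \<Rightarrow> real) \<Rightarrow> real" where
  "rel_elementary n t p z = elementary_sum n t (numer p) z / elementary_sum n t (denom p) z"

definition tropically_equivalent :: "nat \<Rightarrow> presentation \<Rightarrow> presentation \<Rightarrow> bool" where
  "tropically_equivalent n p q \<longleftrightarrow> (\<forall>x. maxplus n p x = maxplus n q x)"

definition polynomial_presentation :: "nat \<Rightarrow> presentation \<Rightarrow> bool" where
  "polynomial_presentation n p \<longleftrightarrow>
     wf_presentation p \<and> (\<forall>(a, e) \<in> set (numer p) \<union> set (denom p). \<forall>i<n. e i \<in> \<nat>)"

(* For exponents in \<nat>, this agrees with elementary_sum on positive arguments. The Taylor polynomials
   inserted below need not be positive, so powr cannot be used there. *)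
definition poly_eval :: "nat \<Rightarrow> real \<Rightarrow> monomial list \<Rightarrow> (nat \<Rightarrow> real) \<Rightarrow> real" where
  "poly_eval n t L z = (\<Sum>(a, e)\<leftarrow>L. t powr a * (\<Prod>i<n. z i ^ nat \<lfloor>e i\<rfloor>))"


(* Partial derivatives on the closed quadrant, one-sided on its boundary. *)

abbreviation quadrant :: "(real \<times> real) set" where
  "quadrant \<equiv> {0..} \<times> {0..}"

definition partial_x :: "(real \<Rightarrow> real \<Rightarrow> real) \<Rightarrow> real \<Rightarrow> real \<Rightarrow> real" where
  "partial_x u x s = vector_derivative (\<lambda>y. u y s) (at x within {0..})"

definition partial_s :: "(real \<Rightarrow> real \<Rightarrow> real) \<Rightarrow> real \<Rightarrow> real \<Rightarrow> real" where
  "partial_s u x s = vector_derivative (\<lambda>r. u x r) (at s within {0..})"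

fun class_C :: "nat \<Rightarrow> (real \<Rightarrow> real \<Rightarrow> real) \<Rightarrow> bool" where
  "class_C 0 u \<longleftrightarrow> continuous_on quadrant (\<lambda>(x, s). u x s)"
| "class_C (Suc k) u \<longleftrightarrow> continuous_on quadrant (\<lambda>(x, s). u x s) \<and>
     (\<forall>x\<ge>0. \<forall>s\<ge>0. (\<lambda>y. u y s) differentiable (at x within {0..}) \<and>
                  (\<lambda>r. u x r) differentiable (at s within {0..})) \<and>
     class_C k (partial_x u) \<and> class_C k (partial_s u)"

definition positive_fun :: "(real \<Rightarrow> real \<Rightarrow> real) \<Rightarrow> bool" where
  "positive_fun u \<longleftrightarrow> (\<forall>x\<ge>0. \<forall>s\<ge>0. u x s > 0)"


definition taylor_x :: "nat \<Rightarrow> real \<Rightarrow> nat \<Rightarrow> (real \<Rightarrow> real \<Rightarrow> real) \<Rightarrow> real \<Rightarrow> real \<Rightarrow> real" where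
  "taylor_x \<mu> \<epsilon> i u x s = (\<Sum>k\<le>\<mu>. (real i * \<epsilon>) ^ k / fact k * (partial_x ^^ k) u x s)"

definition taylor_s :: "nat \<Rightarrow> real \<Rightarrow> (real \<Rightarrow> real \<Rightarrow> real) \<Rightarrow> real \<Rightarrow> real \<Rightarrow> real" where
  "taylor_s \<mu> \<epsilon> u x s = (\<Sum>k\<le>\<mu>. \<epsilon> ^ k / fact k * (partial_s ^^ k) u x s)"

(* The variables of f and g are ordered as (v, u_0, u_1, ...), with v at index 0. *)

definition shift_args ::
    "real \<Rightarrow> (real \<Rightarrow> real \<Rightarrow> real) \<Rightarrow> (real \<Rightarrow> real \<Rightarrow> real) \<Rightarrow> real \<Rightarrow> real \<Rightarrow> nat \<Rightarrow> real" where
  "shift_args \<epsilon> u v x s = case_nat (v x s) (\<lambda>i. u (x + real i * \<epsilon>) s)"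

definition taylor_args ::
    "nat \<Rightarrow> real \<Rightarrow> (real \<Rightarrow> real \<Rightarrow> real) \<Rightarrow> (real \<Rightarrow> real \<Rightarrow> real) \<Rightarrow> real \<Rightarrow> real \<Rightarrow> nat \<Rightarrow> real" where
  "taylor_args \<mu> \<epsilon> u v x s = case_nat (v x s) (\<lambda>i. taylor_x \<mu> \<epsilon> i u x s)"

definition P1 :: "nat \<Rightarrow> nat \<Rightarrow> real \<Rightarrow> real \<Rightarrow> presentation \<Rightarrow>
    (real \<Rightarrow> real \<Rightarrow> real) \<Rightarrow> (real \<Rightarrow> real \<Rightarrow> real) \<Rightarrow> real \<Rightarrow> real \<Rightarrow> real" where
  "P1 \<mu> \<alpha> \<epsilon> t f u v x s =
     poly_eval (\<alpha> + 2) t (denom f) (taylor_args \<mu> \<epsilon> u v x s) * taylor_s \<mu> \<epsilon> u x s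
     - poly_eval (\<alpha> + 2) t (numer f) (taylor_args \<mu> \<epsilon> u v x s)"

definition P2 :: "nat \<Rightarrow> nat \<Rightarrow> real \<Rightarrow> real \<Rightarrow> presentation \<Rightarrow>
    (real \<Rightarrow> real \<Rightarrow> real) \<Rightarrow> (real \<Rightarrow> real \<Rightarrow> real) \<Rightarrow> real \<Rightarrow> real \<Rightarrow> real" where
  "P2 \<mu> \<beta> \<epsilon> t g u v x s =
     poly_eval (\<beta> + 2) t (denom g) (taylor_args \<mu> \<epsilon> u v x s) * taylor_x \<mu> \<epsilon> 1 v x s
     - poly_eval (\<beta> + 2) t (numer g) (taylor_args \<mu> \<epsilon> u v x s)"

definition solves_induced_system :: "nat \<Rightarrow> nat \<Rightarrow> nat \<Rightarrow> real \<Rightarrow> real \<Rightarrow> presentation \<Rightarrow> presentation \<Rightarrow>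
    (real \<Rightarrow> real \<Rightarrow> real) \<Rightarrow> (real \<Rightarrow> real \<Rightarrow> real) \<Rightarrow> bool" where
  "solves_induced_system \<mu> \<alpha> \<beta> \<epsilon> t f g u v \<longleftrightarrow>
     (\<forall>x\<ge>0. \<forall>s\<ge>0. P1 \<mu> \<alpha> \<epsilon> t f u v x s = 0 \<and> P2 \<mu> \<beta> \<epsilon> t g u v x s = 0)"

definition E1 :: "nat \<Rightarrow> nat \<Rightarrow> real \<Rightarrow> real \<Rightarrow> presentation \<Rightarrow>
    (real \<Rightarrow> real \<Rightarrow> real) \<Rightarrow> (real \<Rightarrow> real \<Rightarrow> real) \<Rightarrow> real \<Rightarrow> real \<Rightarrow> real" where
  "E1 \<mu> \<alpha> \<epsilon> t f u v x s =
     (u x (s + \<epsilon>) - rel_elementary (\<alpha> + 2) t f (shift_args \<epsilon> u v x s)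
       - P1 \<mu> \<alpha> \<epsilon> t f u v x s / poly_eval (\<alpha> + 2) t (denom f) (shift_args \<epsilon> u v x s))
     / \<epsilon> ^ (\<mu> + 1)"

definition E2 :: "nat \<Rightarrow> nat \<Rightarrow> real \<Rightarrow> real \<Rightarrow> presentation \<Rightarrow>
    (real \<Rightarrow> real \<Rightarrow> real) \<Rightarrow> (real \<Rightarrow> real \<Rightarrow> real) \<Rightarrow> real \<Rightarrow> real \<Rightarrow> real" where
  "E2 \<mu> \<beta> \<epsilon> t g u v x s =
     (v (x + \<epsilon>) s - rel_elementary (\<beta> + 2) t g (shift_args \<epsilon> u v x s)
       - P2 \<mu> \<beta> \<epsilon> t g u v x s / poly_eval (\<beta> + 2) t (denom g) (shift_args \<epsilon> u v x s))
     / \<epsilon> ^ (\<mu> + 1)"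

(* The suprema in norm1 and norm2 are over compact segments, hence finite for functions of
   class C^(mu+1). *)

definition norm1 :: "nat \<Rightarrow> nat \<Rightarrow> real \<Rightarrow> (real \<Rightarrow> real \<Rightarrow> real) \<Rightarrow> real \<Rightarrow> real \<Rightarrow> real" where
  "norm1 \<mu> \<alpha> \<epsilon> u x s =
     (let S = (SUP r\<in>{s..s + \<epsilon>}. \<bar>(partial_s ^^ (\<mu> + 1)) u x r\<bar>)
      in if \<alpha> \<ge> 1 then max (SUP y\<in>{x..x + real \<alpha> * \<epsilon>}. \<bar>(partial_x ^^ (\<mu> + 1)) u y s\<bar>) S else S)"

definition norm2 :: "nat \<Rightarrow> nat \<Rightarrow> real \<Rightarrow> (real \<Rightarrow> real \<Rightarrow> real) \<Rightarrow> (real \<Rightarrow> real \<Rightarrow> real) \<Rightarrow>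
    real \<Rightarrow> real \<Rightarrow> real" where
  "norm2 \<mu> \<beta> \<epsilon> u v x s =
     (let S = (SUP y\<in>{x..x + \<epsilon>}. \<bar>(partial_x ^^ (\<mu> + 1)) v y s\<bar>)
      in if \<beta> \<ge> 1 then max (SUP y\<in>{x..x + real \<beta> * \<epsilon>}. \<bar>(partial_x ^^ (\<mu> + 1)) u y s\<bar>) S else S)"

definition error_bound :: "nat \<Rightarrow> nat \<Rightarrow> nat \<Rightarrow> presentation \<Rightarrow> presentation \<Rightarrow> real \<Rightarrow> bool" where
  "error_bound \<mu> \<alpha> \<beta> f g C \<longleftrightarrow>
     (\<forall>\<epsilon> t u v. 0 < \<epsilon> \<and> \<epsilon> \<le> 1 \<and> t > 1 \<and> positive_fun u \<and> positive_fun v \<and>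
        class_C (\<mu> + 1) u \<and> class_C (\<mu> + 1) v \<longrightarrow>
        (\<forall>x\<ge>0. \<forall>s\<ge>0. \<bar>E1 \<mu> \<alpha> \<epsilon> t f u v x s\<bar> \<le> C * norm1 \<mu> \<alpha> \<epsilon> u x s \<and>
                     \<bar>E2 \<mu> \<beta> \<epsilon> t g u v x s\<bar> \<le> C * norm2 \<mu> \<beta> \<epsilon> u v x s))"

definition is_error_constant :: "nat \<Rightarrow> nat \<Rightarrow> nat \<Rightarrow> presentation \<Rightarrow> presentation \<Rightarrow> real \<Rightarrow> bool" where
  "is_error_constant \<mu> \<alpha> \<beta> f g C \<longleftrightarrow>
     error_bound \<mu> \<alpha> \<beta> f g C \<and> (\<forall>C'. error_bound \<mu> \<alpha> \<beta> f g C' \<longrightarrow> C \<le> C')"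

definition higher_distorsion :: "nat \<Rightarrow> nat \<Rightarrow> nat \<Rightarrow> real \<Rightarrow>
    (real \<Rightarrow> real \<Rightarrow> real) \<Rightarrow> (real \<Rightarrow> real \<Rightarrow> real) \<Rightarrow> ereal" where
  "higher_distorsion \<mu> \<alpha> \<beta> \<epsilon> u v =
     (SUP (x, s)\<in>quadrant. ereal (max (norm1 \<mu> \<alpha> \<epsilon> u x s / u x (s + \<epsilon>))
                                      (norm2 \<mu> \<beta> \<epsilon> u v x s / v (x + \<epsilon>) s)))"


definition pm1 :: "real \<Rightarrow> real" where
  "pm1 a = max a (1 / a)"

definition initial_rate :: "real \<Rightarrow> (real \<Rightarrow> real \<Rightarrow> real) \<Rightarrow> (real \<Rightarrow> real \<Rightarrow> real) \<Rightarrow>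
    (real \<Rightarrow> real \<Rightarrow> real) \<Rightarrow> (real \<Rightarrow> real \<Rightarrow> real) \<Rightarrow> ereal" where
  "initial_rate \<epsilon> u v u' v' =
     max (SUP (x, s)\<in>{0..} \<times> {0..\<epsilon>}. ereal (pm1 (u x s / u' x s)))
         (SUP (x, s)\<in>{0..\<epsilon>} \<times> {0..}. ereal (pm1 (v x s / v' x s)))"

(* Only used for X >= 0 and r > 0. *)
definition ereal_powr :: "ereal \<Rightarrow> real \<Rightarrow> ereal" where
  "ereal_powr X r = (if X = \<infinity> then \<infinity> else ereal (real_of_ereal X powr r))"

definition geom :: "real \<Rightarrow> real \<Rightarrow> real" where
  "geom r c = (if c = 1 then r + 1 else (c powr (r + 1) - 1) / (c - 1))"

end

(* Along a solution the remainder \<epsilon>^(\<mu>+1) E_1 is at most (1 - \<delta>) u(x, s + \<epsilon>), so u(x, s + \<epsilon>) agrees with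
   f(v(x, s), u(x, s), ..., u(x + \<alpha>\<epsilon>, s)) up to a factor N_0, and similarly for v and g. In logarithmic
   coordinates ln f differs from the corresponding (max,+)-function by at most ln M, and tropically
   equivalent functions share a c-Lipschitz (max,+)-function. Hence \<bar>ln u^1 - ln u^2\<bar> and
   \<bar>ln v^1 - ln v^2\<bar> satisfy a recursion of the shape \<rho> \<le> A + c max \<rho> with A = 2 ln (N_0 M), and it
   remains to count its steps. This gives the exponent 2 P_r(c), better than the claimed 6 P_r(c). *)

theory Submission
  imports Defs
begin

lemma log_sum_exp_bounds:
  fixes xs :: "real list"
  assumes "xs \<noteq> []"
  shows "0 < (\<Sum>x\<leftarrow>xs. exp x)"
    and "Max (set xs) \<le> ln (\<Sum>x\<leftarrow>xs. exp x)"
    and "ln (\<Sum>x\<leftarrow>xs. exp x) \<le> Max (set xs) + ln (real (length xs))"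
proof -
  have "exp (Max (set xs)) \<le> (\<Sum>x\<leftarrow>xs. exp x)"
    by (rule member_le_sum_list) (use assms in auto)
  then show pos: "0 < (\<Sum>x\<leftarrow>xs. exp x)"
    by (rule less_le_trans[OF exp_gt_zero])
  with \<open>exp (Max (set xs)) \<le> _\<close> show "Max (set xs) \<le> ln (\<Sum>x\<leftarrow>xs. exp x)"
    by (simp add: ln_ge_iff)
  have "(\<Sum>x\<leftarrow>xs. exp x) \<le> (\<Sum>x\<leftarrow>xs. exp (Max (set xs)))"
    by (rule sum_list_mono) simp
  also have "\<dots> = exp (Max (set xs) + ln (real (length xs)))"
    using assms by (simp add: sum_list_triv exp_add)
  finally show "ln (\<Sum>x\<leftarrow>xs. exp x) \<le> Max (set xs) + ln (real (length xs))"
    using pos by (metis exp_gt_zero ln_exp ln_le_cancel_iff)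
qed

lemma elementary_sum_exp:
  assumes "t > 1" and "\<forall>i<n. z i > 0"
  shows "elementary_sum n t L z =
    (\<Sum>y\<leftarrow>map (\<lambda>(a, e). ln t * (a + (\<Sum>i<n. of_rat (e i) * (ln (z i) / ln t)))) L. exp y)"
proof -
  have "t powr a * (\<Prod>i<n. z i powr of_rat (e i)) =
      exp (ln t * (a + (\<Sum>i<n. of_rat (e i) * (ln (z i) / ln t))))" for a and e :: "nat \<Rightarrow> rat"
  proof -
    have "(\<Prod>i<n. z i powr of_rat (e i)) = exp (\<Sum>i<n. of_rat (e i) * ln (z i))"
      unfolding exp_sum[OF finite_lessThan] using assms(2)
      by (intro prod.cong) (auto simp: powr_def)
    moreover have "(\<Sum>i<n. of_rat (e i) * ln (z i)) =
        ln t * (\<Sum>i<n. of_rat (e i) * (ln (z i) / ln t))"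
      unfolding sum_distrib_left using assms(1) by (intro sum.cong) auto
    moreover have "t powr a = exp (ln t * a)"
      using assms(1) by (simp add: powr_def mult.commute)
    ultimately show ?thesis by (simp add: distrib_left exp_add)
  qed
  then show ?thesis
    unfolding elementary_sum_def map_map by (intro arg_cong[where f = sum_list] map_cong) auto
qed

lemma ln_elementary_sum_bounds:
  assumes "t > 1" and "\<forall>i<n. z i > 0" and "L \<noteq> []"
  defines "y \<equiv> \<lambda>i. ln (z i) / ln t"
  shows "elementary_sum n t L z > 0"
    and "ln t * max_affine n L y \<le> ln (elementary_sum n t L z)"
    and "ln (elementary_sum n t L z) \<le> ln t * max_affine n L y + ln (real (length L))"
proof -
  let ?F = "\<lambda>(a, e). a + (\<Sum>i<n. of_rat (e i) * y i)"
  let ?xs = "map (\<lambda>p. ln t * ?F p) L"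
  have E: "elementary_sum n t L z = (\<Sum>y\<leftarrow>?xs. exp y)"
    unfolding elementary_sum_exp[OF assms(1,2)] y_def
    by (intro arg_cong[where f = sum_list] map_cong refl) auto
  have "Max (set ?xs) = Max ((\<lambda>r. ln t * r) ` (?F ` set L))"
    by (simp add: image_image)
  also have "\<dots> = ln t * max_affine n L y"
    unfolding max_affine_def using assms
    by (subst mono_Max_commute[symmetric]) (auto simp: mono_def)
  finally have M: "Max (set ?xs) = ln t * max_affine n L y" .
  show "elementary_sum n t L z > 0"
    unfolding E using assms(3) by (intro log_sum_exp_bounds(1)) simp
  show "ln t * max_affine n L y \<le> ln (elementary_sum n t L z)"
    and "ln (elementary_sum n t L z) \<le> ln t * max_affine n L y + ln (real (length L))"
    using log_sum_exp_bounds(2,3)[of ?xs] assms(3) unfolding E M by auto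
qed

lemma ln_rel_elementary_maxplus:
  assumes "t > 1" and "\<forall>i<n. z i > 0" and "wf_presentation p"
  shows "\<bar>ln (rel_elementary n t p z) - ln t * maxplus n p (\<lambda>i. ln (z i) / ln t)\<bar>
           \<le> ln (real (num_components p))"
proof -
  have ne: "numer p \<noteq> []" "denom p \<noteq> []"
    using assms(3) by (auto simp: wf_presentation_def)
  note a = ln_elementary_sum_bounds[OF assms(1,2) ne(1)]
  note b = ln_elementary_sum_bounds[OF assms(1,2) ne(2)]
  have "ln (rel_elementary n t p z) = ln (elementary_sum n t (numer p) z) - ln (elementary_sum n t (denom p) z)"
    using a(1) b(1) by (simp add: rel_elementary_def ln_div)
  moreover have "ln (real (num_components p)) = ln (real (length (numer p))) + ln (real (length (denom p)))"
    using ne by (simp add: num_components_def ln_mult)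
  moreover have "ln (real (length (numer p))) \<ge> 0" "ln (real (length (denom p))) \<ge> 0"
    using ne by (simp_all add: Suc_leI)
  ultimately show "\<bar>ln (rel_elementary n t p z) - ln t * maxplus n p (\<lambda>i. ln (z i) / ln t)\<bar>
           \<le> ln (real (num_components p))"
    using a(2,3) b(2,3) unfolding maxplus_def right_diff_distrib by linarith
qed

lemma abs_diff_le_sup_dist: "i < n \<Longrightarrow> \<bar>x i - y i\<bar> \<le> sup_dist n x y"
  unfolding sup_dist_def by (rule Max_ge) auto

lemma sup_dist_le: "n > 0 \<Longrightarrow> (\<And>i. i < n \<Longrightarrow> \<bar>x i - y i\<bar> \<le> r) \<Longrightarrow> sup_dist n x y \<le> r"
  unfolding sup_dist_def by (subst Max_le_iff) auto

lemma sup_dist_nonneg: "n > 0 \<Longrightarrow> sup_dist n x y \<ge> 0"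
  using abs_diff_le_sup_dist[of 0 n x y] by linarith

lemma sup_dist_commute: "sup_dist n x y = sup_dist n y x"
  by (simp add: sup_dist_def abs_minus_commute)

lemma max_affine_lipschitz:
  assumes "n > 0" and "L \<noteq> []"
  shows "\<exists>K\<ge>0. \<forall>x y. \<bar>max_affine n L x - max_affine n L y\<bar> \<le> K * sup_dist n x y"
proof -
  define K :: real where "K = (\<Sum>(a, e)\<in>set L. \<Sum>i<n. \<bar>of_rat (e i)\<bar>)"
  have "K \<ge> 0"
    unfolding K_def by (auto intro!: sum_nonneg)
  have "max_affine n L x \<le> max_affine n L y + K * sup_dist n x y" for x y
  proof -
    have "a + (\<Sum>i<n. of_rat (e i) * x i) \<le> max_affine n L y + K * sup_dist n x y"
      if "(a, e) \<in> set L" for a e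
    proof -
      have "(\<Sum>i<n. of_rat (e i) * x i) - (\<Sum>i<n. of_rat (e i) * y i) = (\<Sum>i<n. of_rat (e i) * (x i - y i))"
        by (simp add: sum_subtractf right_diff_distrib)
      also have "\<dots> \<le> (\<Sum>i<n. \<bar>of_rat (e i)\<bar> * sup_dist n x y)"
      proof (rule sum_mono)
        fix i assume "i \<in> {..<n}"
        then have "\<bar>of_rat (e i)\<bar> * \<bar>x i - y i\<bar> \<le> \<bar>of_rat (e i)\<bar> * sup_dist n x y"
          by (intro mult_left_mono abs_diff_le_sup_dist) auto
        then show "of_rat (e i) * (x i - y i) \<le> \<bar>of_rat (e i)\<bar> * sup_dist n x y"
          by (metis abs_le_D1 abs_mult)
      qed
      also have "\<dots> = (\<Sum>i<n. \<bar>of_rat (e i)\<bar>) * sup_dist n x y"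
        by (simp add: sum_distrib_right)
      also have "\<dots> \<le> K * sup_dist n x y"
      proof (rule mult_right_mono)
        have "(\<lambda>(a, e). \<Sum>i<n. \<bar>of_rat (e i)\<bar> :: real) (a, e) \<le> K"
          unfolding K_def by (rule member_le_sum) (use that in \<open>auto intro!: sum_nonneg\<close>)
        then show "(\<Sum>i<n. \<bar>of_rat (e i)\<bar>) \<le> K" by simp
      qed (rule sup_dist_nonneg[OF assms(1)])
      finally have "(\<Sum>i<n. of_rat (e i) * x i) \<le> (\<Sum>i<n. of_rat (e i) * y i) + K * sup_dist n x y"
        by simp
      moreover have "a + (\<Sum>i<n. of_rat (e i) * y i) \<le> max_affine n L y"
        unfolding max_affine_def by (rule Max_ge) (use that in force)+
      ultimately show ?thesis by linarith
    qed
    then show ?thesis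
      unfolding max_affine_def[of n L x] using assms(2) by (subst Max_le_iff) auto
  qed
  then have "\<bar>max_affine n L x - max_affine n L y\<bar> \<le> K * sup_dist n x y" for x y
    by (smt (verit) sup_dist_commute)
  with \<open>K \<ge> 0\<close> show ?thesis by blast
qed

lemma maxplus_lipschitz:
  assumes "n > 0" and "wf_presentation p"
  shows "0 \<le> lipschitz_const n (maxplus n p)"
    and "\<bar>maxplus n p x - maxplus n p y\<bar> \<le> lipschitz_const n (maxplus n p) * sup_dist n x y"
proof -
  let ?S = "{L. 0 \<le> L \<and> (\<forall>x y. \<bar>maxplus n p x - maxplus n p y\<bar> \<le> L * sup_dist n x y)}"
  obtain K1 K2 where "K1 \<ge> 0" "K2 \<ge> 0"
    and K: "\<And>x y. \<bar>max_affine n (numer p) x - max_affine n (numer p) y\<bar> \<le> K1 * sup_dist n x y"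
      "\<And>x y. \<bar>max_affine n (denom p) x - max_affine n (denom p) y\<bar> \<le> K2 * sup_dist n x y"
    using max_affine_lipschitz[OF assms(1)] assms(2) unfolding wf_presentation_def by meson
  have bound: "\<bar>maxplus n p x - maxplus n p y\<bar> \<le> (K1 + K2) * sup_dist n x y" for x y
    using K[of x y] unfolding maxplus_def distrib_right by linarith
  with \<open>K1 \<ge> 0\<close> \<open>K2 \<ge> 0\<close> have S: "K1 + K2 \<in> ?S"
    by auto
  show "0 \<le> lipschitz_const n (maxplus n p)"
    unfolding lipschitz_const_def by (rule cInf_greatest) (use S in auto)
  show "\<bar>maxplus n p x - maxplus n p y\<bar> \<le> lipschitz_const n (maxplus n p) * sup_dist n x y"
  proof (cases "sup_dist n x y = 0")
    case True
    then show ?thesis using bound[of x y] by simp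
  next
    case False
    then have d: "sup_dist n x y > 0"
      using sup_dist_nonneg[OF assms(1), of x y] by linarith
    have "\<bar>maxplus n p x - maxplus n p y\<bar> / sup_dist n x y \<le> lipschitz_const n (maxplus n p)"
      unfolding lipschitz_const_def
      by (rule cInf_greatest) (use S d in \<open>auto simp: pos_divide_le_eq\<close>)
    with d show ?thesis by (simp add: pos_divide_le_eq)
  qed
qed

lemma rel_elementary_comparison:
  assumes "t > 1" and "n > 0" and "wf_presentation p" and "wf_presentation q"
    and "tropically_equivalent n p q"
    and "\<forall>i<n. z i > 0" and "\<forall>i<n. w i > 0"
    and "\<And>i. i < n \<Longrightarrow> \<bar>ln (z i) - ln (w i)\<bar> \<le> m"
  shows "\<bar>ln (rel_elementary n t p z) - ln (rel_elementary n t q w)\<bar>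
    \<le> ln (real (num_components p)) + ln (real (num_components q)) + lipschitz_const n (maxplus n p) * m"
proof -
  let ?z = "\<lambda>i. ln (z i) / ln t" and ?w = "\<lambda>i. ln (w i) / ln t"
  have t: "ln t > 0" using assms(1) by simp
  have "sup_dist n ?z ?w \<le> m / ln t"
  proof (rule sup_dist_le[OF assms(2)])
    fix i assume "i < n"
    then show "\<bar>?z i - ?w i\<bar> \<le> m / ln t"
      using assms(8) t by (simp add: diff_divide_distrib[symmetric] divide_right_mono)
  qed
  then have "\<bar>maxplus n p ?z - maxplus n p ?w\<bar> \<le> lipschitz_const n (maxplus n p) * (m / ln t)"
    using maxplus_lipschitz[OF assms(2,3)] by (meson mult_left_mono order_trans)
  then have "ln t * \<bar>maxplus n p ?z - maxplus n p ?w\<bar> \<le> lipschitz_const n (maxplus n p) * m"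
    using t by (simp add: field_simps)
  then have "\<bar>ln t * maxplus n p ?z - ln t * maxplus n p ?w\<bar> \<le> lipschitz_const n (maxplus n p) * m"
    using t by (simp add: right_diff_distrib[symmetric] abs_mult)
  moreover have eq: "maxplus n q ?w = maxplus n p ?w"
    using assms(5) by (simp add: tropically_equivalent_def)
  ultimately show ?thesis
    using ln_rel_elementary_maxplus[OF assms(1,6,3)]
      ln_rel_elementary_maxplus[OF assms(1,7,4), unfolded eq]
    by linarith
qed

lemma class_C_partial_pow:
  assumes "class_C k u"
  shows "continuous_on quadrant (\<lambda>(x, s). (partial_x ^^ k) u x s)"
    and "continuous_on quadrant (\<lambda>(x, s). (partial_s ^^ k) u x s)"
  using assms
proof (induction k arbitrary: u)
  case (Suc k)
  {
    case 1
    then show ?case using Suc.IH(1)[of "partial_x u"] by (simp add: funpow_swap1)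
  next
    case 2
    then show ?case using Suc.IH(2)[of "partial_s u"] by (simp add: funpow_swap1)
  }
qed simp_all

lemma SUP_abs_nonneg:
  fixes h :: "real \<Rightarrow> real"
  assumes "continuous_on {a..b} h" and "a \<le> b"
  shows "0 \<le> (SUP r\<in>{a..b}. \<bar>h r\<bar>)"
proof -
  have "compact ((\<lambda>r. \<bar>h r\<bar>) ` {a..b})"
    using assms(1) by (intro compact_continuous_image continuous_intros) auto
  then have "\<bar>h a\<bar> \<le> (SUP r\<in>{a..b}. \<bar>h r\<bar>)"
    using assms(2) by (intro cSUP_upper bounded_imp_bdd_above compact_imp_bounded) auto
  then show ?thesis by linarith
qed

lemma norms_nonneg:
  assumes "class_C (\<mu> + 1) u" and "class_C (\<mu> + 1) v" and "x \<ge> 0" and "s \<ge> 0" and "\<epsilon> > 0"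
  shows "0 \<le> norm1 \<mu> \<alpha> \<epsilon> u x s" and "0 \<le> norm2 \<mu> \<beta> \<epsilon> u v x s"
proof -
  have "continuous_on {s..s + \<epsilon>} (\<lambda>r. case (x, r) of (x, s) \<Rightarrow> (partial_s ^^ (\<mu> + 1)) u x s)"
    by (rule continuous_on_compose2[OF class_C_partial_pow(2)[OF assms(1)]])
      (use assms in \<open>auto intro!: continuous_intros\<close>)
  then have "0 \<le> (SUP r\<in>{s..s + \<epsilon>}. \<bar>(partial_s ^^ (\<mu> + 1)) u x r\<bar>)"
    using assms(5) by (intro SUP_abs_nonneg) (simp_all del: funpow.simps)
  then show "0 \<le> norm1 \<mu> \<alpha> \<epsilon> u x s"
    unfolding norm1_def Let_def by (auto simp: le_max_iff_disj)
  have "continuous_on {x..x + \<epsilon>} (\<lambda>y. case (y, s) of (x, s) \<Rightarrow> (partial_x ^^ (\<mu> + 1)) v x s)"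
    by (rule continuous_on_compose2[OF class_C_partial_pow(1)[OF assms(2)]])
      (use assms in \<open>auto intro!: continuous_intros\<close>)
  then have "0 \<le> (SUP y\<in>{x..x + \<epsilon>}. \<bar>(partial_x ^^ (\<mu> + 1)) v y s\<bar>)"
    using assms(5) by (intro SUP_abs_nonneg) (simp_all del: funpow.simps)
  then show "0 \<le> norm2 \<mu> \<beta> \<epsilon> u v x s"
    unfolding norm2_def Let_def by (auto simp: le_max_iff_disj)
qed

lemma remainder_bound:
  fixes K :: ereal
  assumes "0 < \<epsilon>" and "\<epsilon> \<le> 1" and "0 < b" and "0 \<le> N" and "C' \<le> C"
    and "\<bar>d / \<epsilon> ^ (\<mu> + 1)\<bar> \<le> C' * N" and "ereal (N / b) \<le> K"
    and "0 \<le> ereal C * K" and "ereal C * K \<le> ereal ((1 - \<delta>) / \<epsilon>)"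
  shows "\<bar>d\<bar> \<le> (1 - \<delta>) * b"
proof -
  have "0 \<le> ereal ((1 - \<delta>) / \<epsilon>)" using assms(8,9) by (rule order_trans)
  then have \<delta>: "0 \<le> (1 - \<delta>) / \<epsilon>" by simp
  have "C * (N / b) \<le> (1 - \<delta>) / \<epsilon>"
  proof (cases "C \<ge> 0")
    case True
    then have "ereal C * ereal (N / b) \<le> ereal C * K"
      by (intro ereal_mult_left_mono assms(7)) simp
    with assms(9) show ?thesis by (simp add: order_trans flip: ereal_less_eq(3))
  next
    case False
    then have "C * (N / b) \<le> 0"
      using assms(3,4) by (intro mult_nonpos_nonneg) auto
    with \<delta> show ?thesis by linarith
  qed
  then have "C * N \<le> (1 - \<delta>) / \<epsilon> * b"
    using assms(3) by (simp add: field_simps)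
  moreover have "C' * N \<le> C * N"
    using assms(4,5) by (rule mult_right_mono[rotated])
  moreover have "\<bar>d\<bar> / \<epsilon> ^ (\<mu> + 1) \<le> C' * N"
    using assms(1,6) by (simp add: abs_divide)
  ultimately have "\<bar>d\<bar> / \<epsilon> ^ (\<mu> + 1) \<le> (1 - \<delta>) / \<epsilon> * b" by linarith
  then have "\<bar>d\<bar> \<le> (1 - \<delta>) / \<epsilon> * b * \<epsilon> ^ (\<mu> + 1)"
    using assms(1) by (simp only: pos_divide_le_eq zero_less_power)
  also have "\<dots> = ((1 - \<delta>) * b) * \<epsilon> ^ \<mu>"
    using assms(1) by simp
  also have "\<dots> \<le> ((1 - \<delta>) * b) * 1"
    using \<delta> assms(1,2,3) by (intro mult_left_mono power_le_one) (auto simp: zero_le_divide_iff)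
  finally show ?thesis by simp
qed

lemma solution_approximates_dynamics:
  assumes "t > 1" and "0 < \<epsilon>" and "\<epsilon> \<le> 1"
    and "error_bound \<mu> \<alpha> \<beta> f g C'" and "C' \<le> C"
    and "positive_fun u" and "positive_fun v"
    and "class_C (\<mu> + 1) u" and "class_C (\<mu> + 1) v"
    and "solves_induced_system \<mu> \<alpha> \<beta> \<epsilon> t f g u v"
    and "0 \<le> ereal C * higher_distorsion \<mu> \<alpha> \<beta> \<epsilon> u v"
    and "ereal C * higher_distorsion \<mu> \<alpha> \<beta> \<epsilon> u v \<le> ereal ((1 - \<delta>) / \<epsilon>)"
    and "x \<ge> 0" and "s \<ge> 0"
  shows "\<bar>u x (s + \<epsilon>) - rel_elementary (\<alpha> + 2) t f (shift_args \<epsilon> u v x s)\<bar> \<le> (1 - \<delta>) * u x (s + \<epsilon>)"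
    and "\<bar>v (x + \<epsilon>) s - rel_elementary (\<beta> + 2) t g (shift_args \<epsilon> u v x s)\<bar> \<le> (1 - \<delta>) * v (x + \<epsilon>) s"
proof -
  have E: "\<bar>E1 \<mu> \<alpha> \<epsilon> t f u v x s\<bar> \<le> C' * norm1 \<mu> \<alpha> \<epsilon> u x s"
    "\<bar>E2 \<mu> \<beta> \<epsilon> t g u v x s\<bar> \<le> C' * norm2 \<mu> \<beta> \<epsilon> u v x s"
    using assms unfolding error_bound_def by blast+
  have P: "P1 \<mu> \<alpha> \<epsilon> t f u v x s = 0" "P2 \<mu> \<beta> \<epsilon> t g u v x s = 0"
    using assms(10,13,14) by (auto simp: solves_induced_system_def)
  have K: "ereal (norm1 \<mu> \<alpha> \<epsilon> u x s / u x (s + \<epsilon>)) \<le> higher_distorsion \<mu> \<alpha> \<beta> \<epsilon> u v"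
    "ereal (norm2 \<mu> \<beta> \<epsilon> u v x s / v (x + \<epsilon>) s) \<le> higher_distorsion \<mu> \<alpha> \<beta> \<epsilon> u v"
    unfolding higher_distorsion_def using assms(13,14) by (auto intro!: SUP_upper2[of "(x, s)"])
  have pos: "u x (s + \<epsilon>) > 0" "v (x + \<epsilon>) s > 0"
    using assms(2,6,7,13,14) by (auto simp: positive_fun_def)
  note N = norms_nonneg[OF assms(8,9,13,14,2)]
  show "\<bar>u x (s + \<epsilon>) - rel_elementary (\<alpha> + 2) t f (shift_args \<epsilon> u v x s)\<bar> \<le> (1 - \<delta>) * u x (s + \<epsilon>)"
    using E(1) unfolding E1_def P
    by (intro remainder_bound[OF assms(2,3) pos(1) N(1) assms(5) _ K(1) assms(11,12)]) simp
  show "\<bar>v (x + \<epsilon>) s - rel_elementary (\<beta> + 2) t g (shift_args \<epsilon> u v x s)\<bar> \<le> (1 - \<delta>) * v (x + \<epsilon>) s"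
    using E(2) unfolding E2_def P
    by (intro remainder_bound[OF assms(2,3) pos(2) N(2) assms(5) _ K(2) assms(11,12)]) simp
qed

lemma ln_diff_of_relative_error:
  fixes a b \<delta> N :: real
  assumes "\<bar>b - a\<bar> \<le> (1 - \<delta>) * b" and "b > 0" and "\<delta> > 0" and "N \<ge> 1 / \<delta>" and "N \<ge> 2 - \<delta>"
  shows "\<bar>ln b - ln a\<bar> \<le> ln N"
proof -
  have N: "N > 0" using assms(3,4) by (meson divide_pos_pos less_le_trans zero_less_one)
  have lo: "\<delta> * b \<le> a" and up: "a \<le> (2 - \<delta>) * b"
    using assms(1) by (simp_all add: algebra_simps abs_le_iff)
  from assms(2,3) have "\<delta> * b > 0" by simp
  with lo have a: "a > 0" by linarith
  have "b = 1 / \<delta> * (\<delta> * b)" using assms(3) by simp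
  also have "\<dots> \<le> N * a"
    using lo assms(2,3,4) N by (intro mult_mono) auto
  finally have "ln b \<le> ln (N * a)"
    using assms(2) by simp
  then have "ln b \<le> ln N + ln a"
    using N a by (simp add: ln_mult)
  moreover have "a \<le> N * b"
    using up assms(2,5) by (meson mult_right_mono less_imp_le order_trans)
  then have "ln a \<le> ln (N * b)"
    using a by simp
  then have "ln a \<le> ln N + ln b"
    using N assms(2) by (simp add: ln_mult)
  ultimately show ?thesis by linarith
qed

lemma geom_step: "c \<ge> 0 \<Longrightarrow> 1 + c * geom (r - 1) c = geom r c"
  by (cases "c = 0") (auto simp: geom_def powr_add field_simps)

lemma geom_mono:
  assumes "c \<ge> 0" and "r \<le> r'"
  shows "geom r c \<le> geom r' c"
proof -
  consider "c = 0" | "c = 1" | "c > 1" | "0 < c" "c < 1" using assms(1) by linarith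
  then show ?thesis
  proof cases
    case 4
    then have "c powr (r' + 1) \<le> c powr (r + 1)"
      using assms(2) by (intro powr_mono') auto
    with 4 show ?thesis by (simp add: geom_def divide_right_mono_neg)
  qed (use assms(2) in \<open>auto simp: geom_def divide_right_mono powr_mono\<close>)
qed

lemma geom_nonneg:
  assumes "c \<ge> 0" and "r \<ge> -1"
  shows "geom r c \<ge> 0"
proof -
  have "0 \<le> geom (-1) c" by (simp add: geom_def)
  also have "\<dots> \<le> geom r c" using assms by (rule geom_mono)
  finally show ?thesis .
qed

(* A step of the u-recursion leads from u(x, s) to v(x, s - \<epsilon>) and u(x + i\<epsilon>, s - \<epsilon>), a step of the
   v-recursion from v(x, s) to v(x - \<epsilon>, s) and u(x + (i - 1)\<epsilon>, s). The weight W alone may increase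
   in the last case, but W - \<gamma> for u and W for v drop by at least 1 in every step. *)
lemma recursion_growth:
  fixes \<rho>u \<rho>v :: "real \<Rightarrow> real \<Rightarrow> real" and \<alpha> \<beta> \<gamma> :: nat
  assumes "0 < \<epsilon>" and "0 \<le> c" and "0 \<le> A" and "0 \<le> J" and "\<alpha> \<le> \<gamma>" and "\<beta> \<le> \<gamma>"
    and initu: "\<And>x s. 0 \<le> x \<Longrightarrow> 0 \<le> s \<Longrightarrow> s \<le> \<epsilon> \<Longrightarrow> \<rho>u x s \<le> J"
    and initv: "\<And>x s. 0 \<le> x \<Longrightarrow> x \<le> \<epsilon> \<Longrightarrow> 0 \<le> s \<Longrightarrow> \<rho>v x s \<le> J"
    and stepu: "\<And>x s m. 0 \<le> x \<Longrightarrow> 0 \<le> s \<Longrightarrow> \<rho>v x s \<le> m \<Longrightarrow>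
      (\<And>i. i \<le> \<alpha> \<Longrightarrow> \<rho>u (x + real i * \<epsilon>) s \<le> m) \<Longrightarrow> \<rho>u x (s + \<epsilon>) \<le> A + c * m"
    and stepv: "\<And>x s m. 0 \<le> x \<Longrightarrow> 0 \<le> s \<Longrightarrow> \<rho>v x s \<le> m \<Longrightarrow>
      (\<And>i. i \<le> \<beta> \<Longrightarrow> \<rho>u (x + real i * \<epsilon>) s \<le> m) \<Longrightarrow> \<rho>v (x + \<epsilon>) s \<le> A + c * m"
    and "0 \<le> x" and "0 \<le> s"
  defines "r \<equiv> (x + s * (real \<gamma> + 1)) / \<epsilon>"
  shows "\<rho>u x s \<le> A * geom r c + max c 1 powr (r + 1) * J"
    and "\<rho>v x s \<le> A * geom r c + max c 1 powr (r + 1) * J"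
proof -
  define G where "G = (\<lambda>r. A * geom r c + max c 1 powr (r + 1) * J)"
  define W where "W = (\<lambda>x s. (x + s * (real \<gamma> + 1)) / \<epsilon>)"
  have G_mono: "G a \<le> G b" if "a \<le> b" for a b
    unfolding G_def using that assms(2,3,4)
    by (intro add_mono mult_left_mono mult_right_mono geom_mono powr_mono) auto
  have G_ge: "J \<le> G a" if "-1 \<le> a" for a
  proof -
    have "1 * J \<le> max c 1 powr (a + 1) * J"
      using that assms(4) by (intro mult_right_mono ge_one_powr_ge_zero) auto
    moreover have "0 \<le> A * geom a c"
      using that assms(2,3) by (intro mult_nonneg_nonneg geom_nonneg) auto
    ultimately show ?thesis by (simp add: G_def)
  qed
  have G_step: "A + c * G (a - 1) \<le> G a" for a
  proof -
    have "c * (max c 1 powr a * J) \<le> max c 1 * (max c 1 powr a * J)"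
      using assms(4) by (intro mult_right_mono) auto
    also have "\<dots> = max c 1 powr (a + 1) * J"
      by (simp add: powr_add)
    finally have "c * (max c 1 powr a * J) \<le> max c 1 powr (a + 1) * J" .
    moreover have "A * geom a c = A + A * c * geom (a - 1) c"
      by (subst geom_step[OF assms(2), symmetric]) (simp add: algebra_simps)
    ultimately show ?thesis by (simp add: G_def algebra_simps)
  qed
  have W_shift: "W (x + y * \<epsilon>) s = W x s + y" "W x (s + y * \<epsilon>) = W x s + y * (real \<gamma> + 1)" for x y s
    using assms(1) by (simp_all add: W_def field_simps)
  have W_ge: "W x s \<ge> 0" if "0 \<le> x" "0 \<le> s" for x s
    unfolding W_def using that assms(1) by (intro divide_nonneg_pos add_nonneg_nonneg mult_nonneg_nonneg) auto
  have claim: "\<forall>x\<ge>0. \<forall>s\<ge>0. (W x s - real \<gamma> \<le> real n \<longrightarrow> \<rho>u x s \<le> G (max (-1) (W x s - real \<gamma> - 1))) \<and>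
      (W x s \<le> real n \<longrightarrow> \<rho>v x s \<le> G (W x s - 1))" for n :: nat
  proof (induction n)
    case 0
    show ?case
    proof (intro allI impI conjI)
      fix x s :: real assume x: "0 \<le> x" and s: "0 \<le> s"
      {
        assume w: "W x s - real \<gamma> \<le> real 0"
        have "s \<le> \<epsilon>"
        proof (rule ccontr)
          assume "\<not> s \<le> \<epsilon>"
          then have "W x (s - \<epsilon>) \<ge> 0" using x by (intro W_ge) auto
          moreover have "W x s = W x (s - \<epsilon>) + (real \<gamma> + 1)"
            using W_shift(2)[of x "s - \<epsilon>" 1] by simp
          ultimately show False using w by simp
        qed
        then show "\<rho>u x s \<le> G (max (-1) (W x s - real \<gamma> - 1))"
          using initu[OF x s] G_ge by (meson max.cobounded1 order_trans)
      next
        assume w: "W x s \<le> real 0"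
        have "x \<le> \<epsilon>"
        proof (rule ccontr)
          assume "\<not> x \<le> \<epsilon>"
          then have "W (x - \<epsilon>) s \<ge> 0" using s by (intro W_ge) auto
          moreover have "W x s = W (x - \<epsilon>) s + 1"
            using W_shift(1)[of "x - \<epsilon>" 1 s] by simp
          ultimately show False using w by simp
        qed
        moreover have "-1 \<le> W x s - 1" using W_ge[OF x s] by simp
        ultimately show "\<rho>v x s \<le> G (W x s - 1)"
          using initv[OF x _ s] G_ge by (meson order_trans)
      }
    qed
  next
    case (Suc n)
    have IHu: "\<rho>u x s \<le> G m"
      if "0 \<le> x" "0 \<le> s" "W x s - real \<gamma> \<le> real n" "-1 \<le> m" "W x s - real \<gamma> - 1 \<le> m" for x s m
      using Suc.IH that G_mono[of "max (-1) (W x s - real \<gamma> - 1)" m] by force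
    have IHv: "\<rho>v x s \<le> G m"
      if "0 \<le> x" "0 \<le> s" "W x s \<le> real n" "W x s - 1 \<le> m" for x s m
      using Suc.IH that G_mono[of "W x s - 1" m] by force
    show ?case
    proof (intro allI impI conjI)
      fix x s :: real assume x: "0 \<le> x" and s: "0 \<le> s"
      {
        assume w: "W x s - real \<gamma> \<le> real (Suc n)"
        show "\<rho>u x s \<le> G (max (-1) (W x s - real \<gamma> - 1))"
        proof (cases "s \<le> \<epsilon>")
          case True
          then show ?thesis using initu[OF x s] G_ge by (meson max.cobounded1 order_trans)
        next
          case False
          define s' where "s' = s - \<epsilon>"
          have s': "0 \<le> s'" and s: "s = s' + \<epsilon>" using False by (auto simp: s'_def)
          have W: "W x s = W x s' + real \<gamma> + 1"
            using W_shift(2)[of x s' 1] by (simp add: s)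
          have W0: "W x s' \<ge> 0" using W_ge[OF x s'] .
          have "\<rho>u x (s' + \<epsilon>) \<le> A + c * G (W x s' - 1)"
          proof (rule stepu[OF x s'])
            show "\<rho>v x s' \<le> G (W x s' - 1)"
              using x s' w W by (intro IHv) auto
            fix i assume "i \<le> \<alpha>"
            then show "\<rho>u (x + real i * \<epsilon>) s' \<le> G (W x s' - 1)"
              using x s' w W W0 assms(1,5) by (intro IHu) (auto simp: W_shift)
          qed
          also have "\<dots> \<le> G (W x s')" by (rule G_step)
          also have "\<dots> = G (max (-1) (W x s - real \<gamma> - 1))" using W W0 by simp
          finally show ?thesis by (simp add: s)
        qed
      next
        assume w: "W x s \<le> real (Suc n)"
        show "\<rho>v x s \<le> G (W x s - 1)"
        proof (cases "x \<le> \<epsilon>")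
          case True
          moreover have "-1 \<le> W x s - 1" using W_ge[OF x s] by simp
          ultimately show ?thesis using initv[OF x _ s] G_ge by (meson order_trans)
        next
          case False
          define x' where "x' = x - \<epsilon>"
          have x': "0 \<le> x'" and x: "x = x' + \<epsilon>" using False by (auto simp: x'_def)
          have W: "W x s = W x' s + 1"
            using W_shift(1)[of x' 1 s] by (simp add: x)
          have W0: "W x' s \<ge> 0" using W_ge[OF x' s] .
          have "\<rho>v (x' + \<epsilon>) s \<le> A + c * G (W x' s - 1)"
          proof (rule stepv[OF x' s])
            show "\<rho>v x' s \<le> G (W x' s - 1)"
              using x' s w W by (intro IHv) auto
            fix i assume "i \<le> \<beta>"
            then show "\<rho>u (x' + real i * \<epsilon>) s \<le> G (W x' s - 1)"
              using x' s w W W0 assms(1,6) by (intro IHu) (auto simp: W_shift)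
          qed
          also have "\<dots> \<le> G (W x' s)" by (rule G_step)
          finally show ?thesis using W by (simp add: x)
        qed
      }
    qed
  qed
  obtain n where n: "W x s \<le> real n" using real_arch_simple by blast
  have "\<rho>u x s \<le> G (max (-1) (W x s - real \<gamma> - 1))" "\<rho>v x s \<le> G (W x s - 1)"
    using claim[of n] assms(11,12) n by force+
  moreover have "G (max (-1) (W x s - real \<gamma> - 1)) \<le> G (W x s)" "G (W x s - 1) \<le> G (W x s)"
    using W_ge[OF assms(11,12)] by (intro G_mono; simp)+
  ultimately show "\<rho>u x s \<le> A * geom r c + max c 1 powr (r + 1) * J"
    "\<rho>v x s \<le> A * geom r c + max c 1 powr (r + 1) * J"
    by (auto simp: G_def W_def r_def)
qed

lemma pm1_eq_exp:
  assumes "a > 0" and "b > 0"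
  shows "pm1 (a / b) = exp \<bar>ln a - ln b\<bar>"
proof -
  have "a / b = exp (ln a - ln b)" and "1 / (a / b) = exp (ln b - ln a)"
    using assms by (simp_all add: exp_diff)
  then show ?thesis unfolding pm1_def by (auto simp: max_def)
qed

lemma shift_args_pos:
  assumes "positive_fun u" and "positive_fun v" and "0 \<le> x" and "0 \<le> s" and "0 < \<epsilon>"
  shows "shift_args \<epsilon> u v x s i > 0"
  using assms by (cases i) (auto simp: shift_args_def positive_fun_def)

lemma ln_shift_args_diff_le:
  assumes "\<bar>ln (v1 x s) - ln (v2 x s)\<bar> \<le> m"
    and "\<And>i. i \<le> \<alpha> \<Longrightarrow> \<bar>ln (u1 (x + real i * \<epsilon>) s) - ln (u2 (x + real i * \<epsilon>) s)\<bar> \<le> m"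
    and "i < \<alpha> + 2"
  shows "\<bar>ln (shift_args \<epsilon> u1 v1 x s i) - ln (shift_args \<epsilon> u2 v2 x s i)\<bar> \<le> m"
  using assms by (cases i) (auto simp: shift_args_def)

theorem theorem1p8:
  fixes t \<epsilon> \<delta> C C1 C2 c c' :: real
    and \<mu> \<alpha> \<beta> \<gamma> M :: nat
    and N0 :: int
    and f1 f2 g1 g2 :: presentation
    and u1 v1 u2 v2 :: "real \<Rightarrow> real \<Rightarrow> real"
  assumes "t > 1" and "0 < \<epsilon>" and "\<epsilon> \<le> 1" and "\<mu> \<ge> 1"
    and "polynomial_presentation (\<alpha> + 2) f1" and "polynomial_presentation (\<alpha> + 2) f2"
    and "polynomial_presentation (\<beta> + 2) g1" and "polynomial_presentation (\<beta> + 2) g2"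
    and "tropically_equivalent (\<alpha> + 2) f1 f2"
    and "tropically_equivalent (\<beta> + 2) g1 g2"
    and "is_error_constant \<mu> \<alpha> \<beta> f1 g1 C1" and "is_error_constant \<mu> \<alpha> \<beta> f2 g2 C2"
    and "C = max C1 C2"
    and "positive_fun u1" and "positive_fun v1" and "positive_fun u2" and "positive_fun v2"
    and "class_C (\<mu> + 1) u1" and "class_C (\<mu> + 1) v1"
    and "class_C (\<mu> + 1) u2" and "class_C (\<mu> + 1) v2"
    and "solves_induced_system \<mu> \<alpha> \<beta> \<epsilon> t f1 g1 u1 v1"
    and "solves_induced_system \<mu> \<alpha> \<beta> \<epsilon> t f2 g2 u2 v2"
    and "\<delta> > 0"
    and "0 \<le> ereal C * higher_distorsion \<mu> \<alpha> \<beta> \<epsilon> u1 v1"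
    and "ereal C * higher_distorsion \<mu> \<alpha> \<beta> \<epsilon> u1 v1 \<le> ereal ((1 - \<delta>) / \<epsilon>)"
    and "0 \<le> ereal C * higher_distorsion \<mu> \<alpha> \<beta> \<epsilon> u2 v2"
    and "ereal C * higher_distorsion \<mu> \<alpha> \<beta> \<epsilon> u2 v2 \<le> ereal ((1 - \<delta>) / \<epsilon>)"
    and "c = Max {lipschitz_const (\<alpha> + 2) (maxplus (\<alpha> + 2) f1),
                  lipschitz_const (\<alpha> + 2) (maxplus (\<alpha> + 2) f2),
                  lipschitz_const (\<beta> + 2) (maxplus (\<beta> + 2) g1),
                  lipschitz_const (\<beta> + 2) (maxplus (\<beta> + 2) g2)}"
    and "M = Max {num_components f1, num_components f2, num_components g1, num_components g2}"
    and "\<gamma> = max \<alpha> \<beta>"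
    and "c' = max c 1"
    and "real_of_int N0 \<ge> max (1 / \<delta>) (2 - \<delta>)"
  shows "\<forall>x\<ge>0. \<forall>s\<ge>0.
    (let r = (x + s * (real \<gamma> + 1)) / \<epsilon>;
         B = ereal ((real_of_int N0 * real M) powr (6 * geom r c))
             * ereal_powr (initial_rate \<epsilon> u1 v1 u2 v2) (c' powr (r + 1))
     in ereal (pm1 (u1 x s / u2 x s)) \<le> B \<and> ereal (pm1 (v1 x s / v2 x s)) \<le> B)"
proof (intro allI impI)
  fix x s :: real assume x: "0 \<le> x" and s: "0 \<le> s"
  note pos = assms(14-17)
  note wf = assms(5-8)[unfolded polynomial_presentation_def, THEN conjunct1]
  define N where "N = real_of_int N0"
  define \<rho>u where "\<rho>u = (\<lambda>x s. \<bar>ln (u1 x s) - ln (u2 x s)\<bar>)"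
  define \<rho>v where "\<rho>v = (\<lambda>x s. \<bar>ln (v1 x s) - ln (v2 x s)\<bar>)"
  have "0 \<le> ereal ((1 - \<delta>) / \<epsilon>)" using assms(25,26) by (rule order_trans)
  then have "\<delta> \<le> 1" using assms(2) by (simp add: zero_le_divide_iff)
  then have N: "N \<ge> 1 / \<delta>" "N \<ge> 2 - \<delta>" "N \<ge> 1"
    using assms(33) by (auto simp: N_def)
  have M1: "num_components p \<ge> 1" if "wf_presentation p" for p
    using that by (simp add: wf_presentation_def num_components_def Suc_le_eq)
  have comp: "num_components p \<le> M" if "p \<in> {f1, f2, g1, g2}" for p
    unfolding assms(30) by (rule Max_ge) (use that in auto)
  have M: "real M \<ge> 1" using M1[OF wf(1)] comp[of f1] by simp
  have lnM: "ln (real (num_components p)) \<le> ln (real M)"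
    if "p \<in> {f1, f2, g1, g2}" "wf_presentation p" for p
    using comp[OF that(1)] M1[OF that(2)] by simp
  have lip: "lipschitz_const (\<alpha> + 2) (maxplus (\<alpha> + 2) f1) \<le> c"
    "lipschitz_const (\<beta> + 2) (maxplus (\<beta> + 2) g1) \<le> c"
    unfolding assms(29) by (intro Max_ge; simp)+
  have c0: "0 \<le> c"
    using maxplus_lipschitz(1)[of "\<alpha> + 2" f1] wf(1) lip(1) by linarith
  define A where "A = 2 * ln (N * real M)"
  have A: "A = 2 * ln N + 2 * ln (real M)"
    using N M by (simp add: A_def ln_mult)
  have A0: "A \<ge> 0" using N(3) M by (simp add: A)
  note err = assms(11,12)[unfolded is_error_constant_def, THEN conjunct1]
  have CC: "C1 \<le> C" "C2 \<le> C" using assms(13) by auto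
  note approx1 = solution_approximates_dynamics[OF assms(1-3) err(1) CC(1) pos(1,2) assms(18,19,22,25,26)]
  note approx2 = solution_approximates_dynamics[OF assms(1-3) err(2) CC(2) pos(3,4) assms(20,21,23,27,28)]
  note ln_err = ln_diff_of_relative_error[OF _ _ assms(24) N(1,2)]
  have step: "\<bar>ln b1 - ln b2\<bar> \<le> A + c * m"
    if p: "p \<in> {f1, f2, g1, g2}" "q \<in> {f1, f2, g1, g2}" "wf_presentation p" "wf_presentation q"
      and eq: "tropically_equivalent (k + 2) p q"
      and lip: "lipschitz_const (k + 2) (maxplus (k + 2) p) \<le> c"
      and xs: "0 \<le> x" "0 \<le> s"
      and m: "\<rho>v x s \<le> m" "\<And>i. i \<le> k \<Longrightarrow> \<rho>u (x + real i * \<epsilon>) s \<le> m"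
      and b: "0 < b1" "0 < b2"
        "\<bar>b1 - rel_elementary (k + 2) t p (shift_args \<epsilon> u1 v1 x s)\<bar> \<le> (1 - \<delta>) * b1"
        "\<bar>b2 - rel_elementary (k + 2) t q (shift_args \<epsilon> u2 v2 x s)\<bar> \<le> (1 - \<delta>) * b2"
    for p q k b1 b2 x s m
  proof -
    have "\<bar>ln (rel_elementary (k + 2) t p (shift_args \<epsilon> u1 v1 x s))
        - ln (rel_elementary (k + 2) t q (shift_args \<epsilon> u2 v2 x s))\<bar>
      \<le> ln (real (num_components p)) + ln (real (num_components q))
        + lipschitz_const (k + 2) (maxplus (k + 2) p) * m"
      using shift_args_pos[OF pos(1,2) xs assms(2)] shift_args_pos[OF pos(3,4) xs assms(2)]
        ln_shift_args_diff_le[of v1 x s v2 m k u1 \<epsilon> u2] m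
      by (intro rel_elementary_comparison[OF assms(1) _ p(3,4) eq]) (auto simp: \<rho>u_def \<rho>v_def)
    moreover have "lipschitz_const (k + 2) (maxplus (k + 2) p) * m \<le> c * m"
      using m(1) lip by (intro mult_right_mono) (auto simp: \<rho>v_def)
    ultimately show ?thesis
      using ln_err[OF b(3,1)] ln_err[OF b(4,2)] lnM[OF p(1,3)] lnM[OF p(2,4)] unfolding A by linarith
  qed
  have stepu: "\<rho>u x (s + \<epsilon>) \<le> A + c * m"
    if "0 \<le> x" "0 \<le> s" "\<rho>v x s \<le> m" "\<And>i. i \<le> \<alpha> \<Longrightarrow> \<rho>u (x + real i * \<epsilon>) s \<le> m" for x s m
    unfolding \<rho>u_def using that pos assms(2)
    by (intro step[OF _ _ wf(1,2) assms(9) lip(1) _ _ _ _ _ _ approx1(1) approx2(1)])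
      (auto simp: positive_fun_def)
  have stepv: "\<rho>v (x + \<epsilon>) s \<le> A + c * m"
    if "0 \<le> x" "0 \<le> s" "\<rho>v x s \<le> m" "\<And>i. i \<le> \<beta> \<Longrightarrow> \<rho>u (x + real i * \<epsilon>) s \<le> m" for x s m
    unfolding \<rho>v_def using that pos assms(2)
    by (intro step[OF _ _ wf(3,4) assms(10) lip(2) _ _ _ _ _ _ approx1(2) approx2(2)])
      (auto simp: positive_fun_def)
  have pm1_u: "pm1 (u1 x s / u2 x s) = exp (\<rho>u x s)" and pm1_v: "pm1 (v1 x s / v2 x s) = exp (\<rho>v x s)"
    if "0 \<le> x" "0 \<le> s" for x s
    using that pos by (simp_all add: pm1_eq_exp \<rho>u_def \<rho>v_def positive_fun_def)
  define I where "I = initial_rate \<epsilon> u1 v1 u2 v2"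
  have Iu: "ereal (exp (\<rho>u x s)) \<le> I" if "0 \<le> x" "0 \<le> s" "s \<le> \<epsilon>" for x s
    unfolding I_def initial_rate_def using that
    by (intro max.coboundedI1 SUP_upper2[of "(x, s)"]) (auto simp: pm1_u)
  have Iv: "ereal (exp (\<rho>v x s)) \<le> I" if "0 \<le> x" "x \<le> \<epsilon>" "0 \<le> s" for x s
    unfolding I_def initial_rate_def using that
    by (intro max.coboundedI2 SUP_upper2[of "(x, s)"]) (auto simp: pm1_v)
  define r where "r = (x + s * (real \<gamma> + 1)) / \<epsilon>"
  have r: "r \<ge> 0" unfolding r_def using x s assms(2) by simp
  have NM: "N * real M \<ge> 1" using N(3) M by (metis mult_mono mult_1 zero_le_one order_trans)
  define B where "B = ereal ((N * real M) powr (6 * geom r c)) * ereal_powr I (c' powr (r + 1))"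
  have "ereal (exp (\<rho>u x s)) \<le> B \<and> ereal (exp (\<rho>v x s)) \<le> B"
  proof (cases "I = \<infinity>")
    case True
    have "N * real M \<noteq> 0" using NM by linarith
    with True have "B = \<infinity>" by (simp add: B_def ereal_powr_def)
    then show ?thesis by simp
  next
    case False
    have "ereal (exp (\<rho>u 0 0)) \<le> I" using assms(2) by (intro Iu) auto
    with False obtain I' where I': "I = ereal I'" "exp (\<rho>u 0 0) \<le> I'"
      by (cases I) auto
    have I1: "I' \<ge> 1"
      using I'(2) by (smt (verit) \<rho>u_def one_le_exp_iff)
    define J where "J = ln I'"
    have J0: "J \<ge> 0" and IJ: "I' = exp J" using I1 by (simp_all add: J_def)
    have initu: "\<rho>u x s \<le> J" if "0 \<le> x" "0 \<le> s" "s \<le> \<epsilon>" for x s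
      using Iu[OF that] by (simp add: I'(1) IJ)
    have initv: "\<rho>v x s \<le> J" if "0 \<le> x" "x \<le> \<epsilon>" "0 \<le> s" for x s
      using Iv[OF that] by (simp add: I'(1) IJ)
    have "\<alpha> \<le> \<gamma>" "\<beta> \<le> \<gamma>" using assms(31) by auto
    note growth = recursion_growth[of \<epsilon> c A J \<alpha> \<gamma> \<beta> \<rho>u \<rho>v, OF assms(2) c0 A0 J0 this]
    have bound: "\<rho>u x s \<le> A * geom r c + c' powr (r + 1) * J"
      "\<rho>v x s \<le> A * geom r c + c' powr (r + 1) * J"
      unfolding r_def assms(32) by (rule growth; fact initu initv stepu stepv x s)+
    have "A * geom r c \<le> 3 * A * geom r c"
      using A0 geom_nonneg[OF c0, of r] r by (intro mult_right_mono) auto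
    moreover have "(N * real M) powr (6 * geom r c) = exp (3 * A * geom r c)"
      using N(3) M unfolding A_def powr_def by simp
    then have B: "B = ereal (exp (3 * A * geom r c + c' powr (r + 1) * J))"
      by (simp add: B_def ereal_powr_def I'(1) IJ exp_powr_real exp_add mult.commute)
    ultimately have "exp (\<rho>u x s) \<le> exp (3 * A * geom r c + c' powr (r + 1) * J)"
      "exp (\<rho>v x s) \<le> exp (3 * A * geom r c + c' powr (r + 1) * J)"
      using bound unfolding exp_le_cancel_iff by linarith+
    then show ?thesis unfolding B ereal_less_eq(3) by blast
  qed
  then show "let r = (x + s * (real \<gamma> + 1)) / \<epsilon>;
         B = ereal ((real_of_int N0 * real M) powr (6 * geom r c))
             * ereal_powr (initial_rate \<epsilon> u1 v1 u2 v2) (c' powr (r + 1))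
     in ereal (pm1 (u1 x s / u2 x s)) \<le> B \<and> ereal (pm1 (v1 x s / v2 x s)) \<le> B"
    unfolding Let_def pm1_u[OF x s] pm1_v[OF x s] B_def I_def N_def r_def .
qed

end
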